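(* Let $M,C,N,O$ be nonnegative integers with $C$, $O$ and $M$ of the same parity, $C\le M$, $O\ge C$, and $N\ge 1$. Let $k$ be a positive integer such that $$kN+1-\binom{N+1}{2}>\frac{M+C}{2}+N+O.$$ Then $k\in\mathcal{A}_{M+1,C+1,N-1,O+1}$ implies $k\in\mathcal{A}_{M,C,N,O}$.
   Context: $\mathcal{Q}_n$ is the $n$-dimensional binary hypercube: its vertices are all binary sequences of length $n$, adjacent iff they differ in exactly one position. A vertex is even or odd according to the parity of its number of 1's; vertices of one parity are called red and those of the other parity green. A path covering of a graph is a set of vertex-disjoint paths that cover all vertices of the graph. A fault $\mathcal{F}$ in $\mathcal{Q}_n$ is a set of deleted vertices; its mass is $|\mathcal{F}|$ and its charge is $|r(\mathcal{F})-g(\mathcal{F})|$, where $r(\mathcal{F})$, $g(\mathcal{F})$ are the numbers of red and green vertices in $\mathcal{F}$. $\mathcal{Q}_n-\mathcal{F}$ is the subgraph induced by the non-deleted vertices. A pair of vertices (or a path, via its two endpoints) is neutral if the two vertices have opposite parity and charged if they have the same parity; a charged pair is red (green) if its elements are red (green). A set $\mathcal{E}$ of disjoint pairs of vertices is in balance with $\mathcal{F}$ if all vertices in the pairs lie in $\mathcal{Q}_n-\mathcal{F}$ and $r(\mathcal{F})-g(\mathcal{F})=g(\mathcal{E})-r(\mathcal{E})$, where $r(\mathcal{E})$, $g(\mathcal{E})$ are the numbers of red and green pairs in $\mathcal{E}$. For a fault $\mathcal{F}$ of mass $M$ and charge $C$ in $\mathcal{Q}_n$, one can freely prescribe ends for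 a path covering of $\mathcal{Q}_n-\mathcal{F}$ with $N$ neutral paths and $O$ charged paths if (i) there is at least one set $\mathcal{E}$ of disjoint pairs of vertices in balance with $\mathcal{F}$ containing exactly $N$ neutral and $O$ charged pairs, and (ii) for every such $\mathcal{E}$ there is a path covering of $\mathcal{Q}_n-\mathcal{F}$ whose set of pairs of end vertices is $\mathcal{E}$. For nonnegative integers $M,C,N,O$, $\mathcal{A}_{M,C,N,O}$ is the set of nonnegative integers $m$ such that $m\ge\log_2[M+C+2N+2O]$ and for every $n\ge m$ and every fault $\mathcal{F}$ of mass $M$ and charge $C$ in $\mathcal{Q}_n$ one can freely prescribe ends for a path covering of $\mathcal{Q}_n-\mathcal{F}$ with $N$ neutral and $O$ charged paths. *)

theory Defs
  imports Complex_Main "HOL-Library.Disjoint_Sets" "Graph_Theory.Graph_Theory"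
begin

definition hypercube :: "nat \<Rightarrow> bool list pair_pre_digraph" where
  "hypercube n =
    \<lparr> pverts = {v. length v = n},
      parcs = {(u, v). length u = n \<and> length v = n \<and> card {i. i < n \<and> u ! i \<noteq> v ! i} = 1} \<rparr>"

text \<open>
  Which parity class is called red is immaterial: charge, neutrality and being in balance,
  and hence the sets \<open>A_set\<close>, are invariant under exchanging the two colours.
\<close>

definition red :: "bool list \<Rightarrow> bool" where
  "red v \<longleftrightarrow> even (count_list v True)"

abbreviation green :: "bool list \<Rightarrow> bool" where
  "green v \<equiv> \<not> red v"

definition fault :: "nat \<Rightarrow> bool list set \<Rightarrow> bool" where
  "fault n F \<longleftrightarrow> F \<subseteq> pverts (hypercube n)"

definition mass :: "bool list set \<Rightarrow> nat" where
  "mass F = card F"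

definition charge :: "bool list set \<Rightarrow> int" where
  "charge F = \<bar>int (card {v \<in> F. red v}) - int (card {v \<in> F. green v})\<bar>"

definition faulty_hypercube :: "nat \<Rightarrow> bool list set \<Rightarrow> (bool list, bool list \<times> bool list) pre_digraph" where
  "faulty_hypercube n F = with_proj (hypercube n) \<restriction> (pverts (hypercube n) - F)"

text \<open>Pairs of vertices are unordered: they are two-element sets.\<close>

definition neutral_pair :: "bool list set \<Rightarrow> bool" where
  "neutral_pair e \<longleftrightarrow> (\<exists>u v. e = {u, v} \<and> red u \<and> green v)"

definition red_pair :: "bool list set \<Rightarrow> bool" where
  "red_pair e \<longleftrightarrow> (\<exists>u v. e = {u, v} \<and> u \<noteq> v \<and> red u \<and> red v)"

definition green_pair :: "bool list set \<Rightarrow> bool" where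
  "green_pair e \<longleftrightarrow> (\<exists>u v. e = {u, v} \<and> u \<noteq> v \<and> green u \<and> green v)"

definition charged_pair :: "bool list set \<Rightarrow> bool" where
  "charged_pair e \<longleftrightarrow> red_pair e \<or> green_pair e"

definition disjoint_pairs :: "bool list set set \<Rightarrow> bool" where
  "disjoint_pairs E \<longleftrightarrow> (\<forall>e\<in>E. card e = 2) \<and> disjoint E"

definition in_balance :: "nat \<Rightarrow> bool list set \<Rightarrow> bool list set set \<Rightarrow> bool" where
  "in_balance n F E \<longleftrightarrow>
    \<Union>E \<subseteq> verts (faulty_hypercube n F) \<and>
    int (card {v \<in> F. red v}) - int (card {v \<in> F. green v}) =
      int (card {e \<in> E. green_pair e}) - int (card {e \<in> E. red_pair e})"

text \<open>
  A path is represented by its list of vertices; a path and its reversal are never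
  both members of a covering, since they share their vertices.
\<close>

definition path_covering :: "('a, 'b) pre_digraph \<Rightarrow> 'a list set \<Rightarrow> bool" where
  "path_covering G P \<longleftrightarrow>
    (\<forall>p\<in>P. vpath p G) \<and> disjoint_family_on set P \<and> (\<Union>p\<in>P. set p) = verts G"

definition path_ends :: "'a list \<Rightarrow> 'a set" where
  "path_ends p = {hd p, last p}"

definition admissible_pairs ::
  "nat \<Rightarrow> bool list set \<Rightarrow> nat \<Rightarrow> nat \<Rightarrow> bool list set set \<Rightarrow> bool" where
  "admissible_pairs n F N Oc E \<longleftrightarrow>
    disjoint_pairs E \<and> in_balance n F E \<and>
    card {e \<in> E. neutral_pair e} = N \<and> card {e \<in> E. charged_pair e} = Oc"

definition freely_prescribe_ends :: "nat \<Rightarrow> bool list set \<Rightarrow> nat \<Rightarrow> nat \<Rightarrow> bool" where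
  "freely_prescribe_ends n F N Oc \<longleftrightarrow>
    (\<exists>E. admissible_pairs n F N Oc E) \<and>
    (\<forall>E. admissible_pairs n F N Oc E \<longrightarrow>
      (\<exists>P. path_covering (faulty_hypercube n F) P \<and> path_ends ` P = E))"

text \<open>
  For \<open>M = C = N = Oc = 0\<close> the bound reads \<open>m \<ge> log 2 0 = 0\<close> and imposes no
  condition on \<open>m\<close>, just as if the logarithm of 0 were minus infinity.
\<close>

definition A_set :: "nat \<Rightarrow> nat \<Rightarrow> nat \<Rightarrow> nat \<Rightarrow> nat set" where
  "A_set M C N Oc =
    {m. real m \<ge> log 2 (real (M + C + 2 * N + 2 * Oc)) \<and>
        (\<forall>n\<ge>m. \<forall>F. fault n F \<and> mass F = M \<and> charge F = int C \<longrightarrow>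
          freely_prescribe_ends n F N Oc)}"

end

theory Submission
  imports Defs
begin

text \<open>
  Let \<open>c\<close> be a colour that at least half of the deleted vertices have, and let a set of \<open>N\<close>
  neutral and \<open>Oc\<close> charged pairs be in balance with the fault. If in some neutral pair
  \<open>{u, v}\<close> the end \<open>u\<close> of colour \<open>c\<close> has a neighbour \<open>w\<close> that is neither deleted nor a
  prescribed end, then \<open>u\<close> can be deleted and \<open>{u, v}\<close> replaced by \<open>{w, v}\<close>. Deleting a
  vertex of the majority colour raises mass and charge by one; the pair \<open>{w, v}\<close> is charged, of
  the minority colour, and so restores the balance (\<open>admissible_pairs_exchange\<close>). A covering for
  the new data has a path from \<open>w\<close> to \<open>v\<close>, and putting \<open>u\<close> in front of that path gives a
  covering for the old data (\<open>path_covering_extend\<close>).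

  Such a \<open>w\<close> exists by counting (\<open>exists_free_neighbour\<close>). Every neighbour of a vertex of
  colour \<open>c\<close> has the other colour, and the obstructions of that colour number
  \<open>(M + C) / 2 + N + Oc\<close>: there are \<open>(M - C) / 2\<close> deleted vertices, one end of each neutral
  pair, and both ends of \<open>(Oc + C) / 2\<close> charged pairs. On the other hand, the \<open>N\<close> ends of
  colour \<open>c\<close> in the neutral pairs have together at least \<open>n * N + 1 - ((N + 1) choose 2)\<close>
  neighbours. This isoperimetric estimate (\<open>card_neighbours_hypercube\<close>) is where the numerical
  hypothesis comes from.

  The same exchange read backwards turns an admissible set of pairs for the larger fault into one
  for the smaller fault, so admissible sets of pairs need not be constructed from scratch.
\<close>

section \<open>Neighbourhoods in the hypercube\<close>

lemma pverts_hypercube [simp]: "pverts (hypercube n) = {v. length v = n}"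
  by (simp add: hypercube_def)

lemma finite_pverts_hypercube: "finite {v :: bool list. length v = n}"
  using finite_lists_length_eq[of "UNIV :: bool set" n] by simp

lemma parcs_hypercube_length:
  "(u, v) \<in> parcs (hypercube n) \<Longrightarrow> length u = n \<and> length v = n"
  by (simp add: hypercube_def)

lemma parcs_hypercube_sym:
  "(u, v) \<in> parcs (hypercube n) \<Longrightarrow> (v, u) \<in> parcs (hypercube n)"
proof -
  have "{i. i < n \<and> u ! i \<noteq> v ! i} = {i. i < n \<and> v ! i \<noteq> u ! i}" by auto
  then show "(u, v) \<in> parcs (hypercube n) \<Longrightarrow> (v, u) \<in> parcs (hypercube n)"
    by (simp add: hypercube_def)
qed

lemma parcs_hypercube_0 [simp]: "parcs (hypercube 0) = {}"
  by (simp add: hypercube_def)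

text \<open>
  The first bit splits the cube into two copies of the next smaller cube joined by a perfect
  matching; the inductions on the dimension below rest on this.
\<close>

lemma parcs_hypercube_Cons:
  "(x # u, y # v) \<in> parcs (hypercube (Suc n)) \<longleftrightarrow>
    (if x = y then (u, v) \<in> parcs (hypercube n) else u = v \<and> length u = n)"
proof (cases "length u = n \<and> length v = n")
  case True
  let ?D = "{i. i < n \<and> u ! i \<noteq> v ! i}"
  have split: "{i. i < Suc n \<and> (x # u) ! i \<noteq> (y # v) ! i} = (if x = y then {} else {0}) \<union> Suc ` ?D"
  proof (rule set_eqI)
    fix i
    show "i \<in> {i. i < Suc n \<and> (x # u) ! i \<noteq> (y # v) ! i} \<longleftrightarrow>
        i \<in> (if x = y then {} else {0}) \<union> Suc ` ?D"
      by (cases i) auto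
  qed
  have "card {i. i < Suc n \<and> (x # u) ! i \<noteq> (y # v) ! i} = (if x = y then 0 else 1) + card ?D"
    unfolding split by (auto simp: card_image card_insert_if)
  moreover have "card ?D = 0 \<longleftrightarrow> u = v"
    using True by (auto intro: nth_equalityI)
  ultimately show ?thesis
    using True by (auto simp: hypercube_def)
qed (auto simp: hypercube_def)

lemma parcs_hypercube_red:
  "(u, v) \<in> parcs (hypercube n) \<Longrightarrow> red v \<longleftrightarrow> \<not> red u"
proof (induction n arbitrary: u v)
  case (Suc n)
  then obtain x u' y v' where uv: "u = x # u'" "v = y # v'"
    by (metis length_Suc_conv parcs_hypercube_length)
  with Suc show ?case
    by (cases x; cases y) (auto simp: parcs_hypercube_Cons red_def)
qed simp

lemma choose_two_add:
  "Suc (a + b) choose 2 = (Suc a choose 2) + (Suc b choose 2) + a * b"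
  by (induction b) (auto simp: numeral_2_eq_2)

text \<open>
  Split \<open>S\<close> by the first bit into parts of sizes \<open>a\<close> and \<open>b\<close>. If both are nonempty, it
  suffices to count the neighbours that each part has within its own half: compared with the claim
  for \<open>S\<close>, the two induction hypotheses lose \<open>a + b\<close> (one dimension less) but gain \<open>1\<close> and
  the cross term \<open>a * b\<close> of the triangular number, and \<open>a + b \<le> a * b + 1\<close> because
  \<open>(a - 1) * (b - 1) \<ge> 0\<close>. If one part is empty, the matching between the halves contributes the
  missing \<open>card S\<close> neighbours. Nonempty sets of vertices of weight one attain the bound.
\<close>

lemma card_neighbours_hypercube:
  assumes "S \<subseteq> {v. length v = n}" and "S \<noteq> {}"
  shows "n * card S + 1 \<le> card (parcs (hypercube n) `` S) + (Suc (card S) choose 2)"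
  using assms
proof (induction n arbitrary: S)
  case 0
  then have "S = {[]}" by auto
  then show ?case by (simp add: numeral_2_eq_2)
next
  case (Suc n)
  let ?N = "\<lambda>n S. parcs (hypercube n) `` S"
  define half where "half x = {v. x # v \<in> S}" for x
  have half: "half x \<subseteq> {v. length v = n}" for x
    using Suc.prems by (auto simp: half_def)
  have fin: "finite (half x)" for x
    using half finite_pverts_hypercube by (rule finite_subset)
  have S: "S = Cons False ` half False \<union> Cons True ` half True"
  proof (intro equalityI subsetI)
    fix v assume "v \<in> S"
    moreover from this Suc.prems obtain x v' where "v = x # v'"
      by (auto simp: length_Suc_conv)
    ultimately show "v \<in> Cons False ` half False \<union> Cons True ` half True"
      by (cases x) (auto simp: half_def)
  qed (auto simp: half_def)
  have cardS: "card S = card (half False) + card (half True)"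
    unfolding S by (subst card_Un_disjoint) (auto simp: card_image fin)
  have N: "?N (Suc n) S = Cons False ` (?N n (half False) \<union> half True)
      \<union> Cons True ` (?N n (half True) \<union> half False)" (is "_ = ?R")
  proof (intro equalityI subsetI)
    fix w assume "w \<in> ?N (Suc n) S"
    then obtain v where v: "v \<in> S" "(v, w) \<in> parcs (hypercube (Suc n))" by auto
    then obtain x v' y w' where eq: "v = x # v'" "w = y # w'"
      by (metis length_Suc_conv parcs_hypercube_length)
    from v show "w \<in> ?R" unfolding eq
      by (cases x; cases y) (auto simp: parcs_hypercube_Cons half_def)
  next
    fix w assume "w \<in> ?R"
    then consider y w' v' where "w = y # w'" "v' \<in> half y" "(v', w') \<in> parcs (hypercube n)"
      | y x w' where "w = y # w'" "w' \<in> half x" "x \<noteq> y"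
      by blast
    then show "w \<in> ?N (Suc n) S"
    proof cases
      case 1
      then show ?thesis
        by (intro ImageI[of "y # v'"]) (auto simp: parcs_hypercube_Cons half_def)
    next
      case 2
      then show ?thesis using half
        by (intro ImageI[of "x # w'"]) (auto simp: parcs_hypercube_Cons half_def)
    qed
  qed
  have finN: "finite (?N n T)" for T
    by (rule finite_subset[OF _ finite_pverts_hypercube[of n]])
      (auto dest: parcs_hypercube_length)
  have cardN: "card (?N (Suc n) S) =
      card (?N n (half False) \<union> half True) + card (?N n (half True) \<union> half False)"
    unfolding N by (subst card_Un_disjoint) (auto simp: card_image fin finN)
  show ?case
  proof (cases "half False = {} \<or> half True = {}")
    case True
    then obtain x where x: "half (\<not> x) = {}"
      by (metis (full_types))
    have "half x \<noteq> {}"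
      using x Suc.prems(2) S by (cases x) auto
    then have IH: "n * card (half x) + 1 \<le> card (?N n (half x)) + (Suc (card (half x)) choose 2)"
      using half Suc.IH by blast
    have "card S = card (half x)" "card (?N (Suc n) S) = card (?N n (half x)) + card (half x)"
      using x cardS cardN by (cases x; simp)+
    with IH show ?thesis by simp
  next
    case False
    let ?a = "card (half False)" and ?b = "card (half True)"
    have pos: "?a \<ge> 1" "?b \<ge> 1"
      using False fin by (auto simp: Suc_le_eq card_gt_0_iff)
    have IH: "n * card (half x) + 1 \<le> card (?N n (half x)) + (Suc (card (half x)) choose 2)" for x
      using False half Suc.IH by (cases x) auto
    have "card (?N n (half False)) \<le> card (?N n (half False) \<union> half True)"
      "card (?N n (half True)) \<le> card (?N n (half True) \<union> half False)"
      by (auto intro!: card_mono simp: fin finN)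
    then have "n * (?a + ?b) + 2 \<le> card (?N (Suc n) S) + (Suc ?a choose 2) + (Suc ?b choose 2)"
      using IH[of False] IH[of True] unfolding cardN by (simp add: algebra_simps)
    moreover obtain a' b' where "?a = Suc a'" "?b = Suc b'"
      using pos by (metis Suc_le_D One_nat_def)
    then have "?a + ?b \<le> ?a * ?b + 1" by simp
    moreover have "Suc (card S) choose 2 = (Suc ?a choose 2) + (Suc ?b choose 2) + ?a * ?b"
      unfolding cardS by (rule choose_two_add)
    ultimately show ?thesis
      unfolding cardS by (simp add: algebra_simps)
  qed
qed

text \<open>
  The last bits may be chosen freely, and the colour then determines the first one.
\<close>

lemma card_colour_class:
  "card {v. length v = Suc n \<and> red v = c} = 2 ^ n"
proof -
  have "bij_betw tl {v. length v = Suc n \<and> red v = c} {v :: bool list. length v = n}"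
  proof (rule bij_betw_byWitness[where f' = "\<lambda>v. (red v \<noteq> c) # v"])
    show "\<forall>v\<in>{v. length v = Suc n \<and> red v = c}. (red (tl v) \<noteq> c) # tl v = v"
      by (auto simp: length_Suc_conv red_def split: if_splits)
  qed (auto simp: red_def split: if_splits)
  then have "card {v. length v = Suc n \<and> red v = c} = card {v :: bool list. length v = n}"
    by (rule bij_betw_same_card)
  then show ?thesis
    using card_lists_length_eq[of "UNIV :: bool set" n] by simp
qed

section \<open>Extending a path covering by one vertex\<close>

lemma verts_faulty_hypercube [simp]:
  "verts (faulty_hypercube n F) = {v. length v = n} - F"
  by (simp add: faulty_hypercube_def)

lemma arcs_ends_faulty_hypercube [simp]:
  "arcs_ends (faulty_hypercube n F) =
    {(u, v) \<in> parcs (hypercube n). u \<notin> F \<and> v \<notin> F}"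
  by (auto simp: faulty_hypercube_def arcs_ends_conv dest: parcs_hypercube_length)

lemma vpath_rev_faulty_hypercube:
  assumes "vpath p (faulty_hypercube n F)"
  shows "vpath (rev p) (faulty_hypercube n F)"
  using assms
  by (auto simp: vpath_def vwalk_def set_vwalk_arcs_rev dest!: subsetD intro: parcs_hypercube_sym)

text \<open>
  The path to extend may run from \<open>v\<close> to \<open>w\<close>, in which case its reversal is used. By
  disjointness no second path has the same ends, so replacing this one path removes the pair
  \<open>{w, v}\<close> from the set of pairs of ends.
\<close>

lemma path_covering_extend:
  assumes cov: "path_covering (faulty_hypercube n (insert u F)) P"
    and ends: "path_ends ` P = insert {w, v} D" and notin: "{w, v} \<notin> D"
    and adj: "(u, w) \<in> parcs (hypercube n)" and "u \<notin> F"
  shows "\<exists>P'. path_covering (faulty_hypercube n F) P' \<and> path_ends ` P' = insert {u, v} D"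
proof -
  let ?G = "faulty_hypercube n (insert u F)" and ?H = "faulty_hypercube n F"
  have vp: "vpath p ?G" if "p \<in> P" for p
    using cov that by (simp add: path_covering_def)
  have disj: "disjoint_family_on set P" and union: "(\<Union>p\<in>P. set p) = verts ?G"
    using cov by (simp_all add: path_covering_def)
  have ne: "p \<noteq> []" if "p \<in> P" for p
    using vp[OF that] by auto
  obtain p where p: "p \<in> P" "path_ends p = {w, v}"
    using ends by (metis image_iff insertI1)
  obtain q where q: "vpath q ?G" "hd q = w" "last q = v" "set q = set p"
  proof (cases "hd p = w \<and> last p = v")
    case True
    then show ?thesis using that vp p by blast
  next
    case False
    then have "hd (rev p) = w" "last (rev p) = v"
      using p(2) ne[OF p(1)] by (auto simp: path_ends_def doubleton_eq_iff hd_rev last_rev)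
    then show ?thesis
      using that vpath_rev_faulty_hypercube[OF vp[OF p(1)]] by simp
  qed
  have qne: "q \<noteq> []" using q(1) by auto
  have mono: "vpath r ?H" if "vpath r ?G" for r
    using that by (auto simp: vpath_def vwalk_def)
  have uq: "u \<notin> set q" and wF: "w \<notin> F"
    using q(1,2) qne hd_in_set by (fastforce simp: vpath_def vwalk_def)+
  have new: "vpath (u # q) ?H"
  proof (rule vpathI)
    show "vwalk (u # q) ?H"
      using mono[OF q(1)] adj \<open>u \<notin> F\<close> wF q(2)
      by (intro vwalk_consI) (auto dest: parcs_hypercube_length)
    show "distinct (u # q)" using q(1) uq by auto
  qed
  let ?P' = "insert (u # q) (P - {p})"
  have other: "set r \<inter> set p = {}" if "r \<in> P - {p}" for r
    using that disj p(1) by (auto simp: disjoint_family_on_def)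
  have uP: "u \<notin> set r" if "r \<in> P" for r
    using union that by auto
  have "path_covering ?H ?P'"
    unfolding path_covering_def
  proof (intro conjI ballI)
    show "vpath r ?H" if "r \<in> ?P'" for r
      using that new mono vp by auto
    show "disjoint_family_on set ?P'"
      using disj other uP q(4) unfolding disjoint_family_on_def by auto
    have "(\<Union>r\<in>?P'. set r) = insert u (\<Union>r\<in>P. set r)"
      using q(4) p(1) by auto
    also have "\<dots> = verts ?H"
      unfolding union using adj \<open>u \<notin> F\<close> by (auto dest: parcs_hypercube_length)
    finally show "(\<Union>r\<in>?P'. set r) = verts ?H" .
  qed
  moreover have "path_ends ` ?P' = insert {u, v} D"
  proof -
    have "path_ends r \<noteq> {w, v}" if "r \<in> P - {p}" for r
    proof
      assume "path_ends r = {w, v}"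
      then have "w \<in> set r" using ne[of r] that by (auto simp: path_ends_def doubleton_eq_iff)
      moreover have "w \<in> set p" using p(2) ne[OF p(1)] by (auto simp: path_ends_def doubleton_eq_iff)
      ultimately show False using other[OF that] by auto
    qed
    then have "path_ends ` (P - {p}) = path_ends ` P - {{w, v}}"
      using p by auto
    also have "\<dots> = D" using ends notin by auto
    finally show ?thesis using q(3) qne by (simp add: path_ends_def)
  qed
  ultimately show ?thesis by blast
qed

section \<open>Pairs of ends\<close>

lemma disjoint_pairs_insert:
  assumes "a \<noteq> b" "a \<notin> \<Union>D" "b \<notin> \<Union>D"
  shows "disjoint_pairs (insert {a, b} D) \<longleftrightarrow> disjoint_pairs D"
  using assms unfolding disjoint_pairs_def disjoint_def by (auto; blast)

lemma disjoint_pairs_rest: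
  assumes "disjoint_pairs E" and "e \<in> E"
  shows "e \<inter> \<Union>(E - {e}) = {}"
proof -
  have "e \<inter> e' = {}" if "e' \<in> E - {e}" for e'
    using assms that disjointD[of E e e'] by (auto simp: disjoint_pairs_def)
  then show ?thesis by blast
qed

lemma card_Collect_insert:
  assumes "finite D" "x \<notin> D"
  shows "card {e \<in> insert x D. Q e} = card {e \<in> D. Q e} + (if Q x then 1 else 0)"
proof -
  have "{e \<in> insert x D. Q e} = (if Q x then insert x {e \<in> D. Q e} else {e \<in> D. Q e})"
    by auto
  then show ?thesis using assms by auto
qed

lemma pair_kinds:
  "neutral_pair {a, b} \<longleftrightarrow> red a \<noteq> red b"
  "red_pair {a, b} \<longleftrightarrow> a \<noteq> b \<and> red a \<and> red b"
  "green_pair {a, b} \<longleftrightarrow> a \<noteq> b \<and> green a \<and> green b"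
  by (auto simp: neutral_pair_def red_pair_def green_pair_def doubleton_eq_iff)

text \<open>
  Both sides of the balance equation move together: deleting \<open>u\<close> adds a vertex of its colour to
  the fault, and \<open>{w, v}\<close> adds a pair of the opposite colour. The forward direction prepares a
  covering, the backward direction produces an admissible set of pairs.
\<close>

lemma admissible_pairs_exchange:
  assumes "finite F" "finite D"
    and V: "{u, v, w} \<subseteq> {v. length v = n} - F" "{u, v, w} \<inter> \<Union>D = {}"
    and col: "red v \<longleftrightarrow> \<not> red u" "red w \<longleftrightarrow> \<not> red u" and "w \<noteq> v"
  shows "admissible_pairs n F (Suc N) Oc (insert {u, v} D) \<longleftrightarrow>
    admissible_pairs n (insert u F) N (Suc Oc) (insert {w, v} D)"
proof -
  have uv: "u \<noteq> v" using col by auto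
  have D: "{u, v} \<notin> D" "{w, v} \<notin> D" using V by auto
  have uF: "u \<notin> F" using V by auto
  note count = card_Collect_insert[OF \<open>finite D\<close> D(1)] card_Collect_insert[OF \<open>finite D\<close> D(2)]
    card_Collect_insert[OF \<open>finite F\<close> uF]
  let ?E = "insert {u, v} D" and ?E' = "insert {w, v} D"
  have "disjoint_pairs ?E \<longleftrightarrow> disjoint_pairs ?E'"
    using V(2) uv \<open>w \<noteq> v\<close> by (simp add: disjoint_pairs_insert)
  moreover have "\<Union>?E \<subseteq> {v. length v = n} - F \<longleftrightarrow> \<Union>?E' \<subseteq> {v. length v = n} - insert u F"
    using V uv \<open>w \<noteq> v\<close> col by blast
  moreover have "card {e \<in> ?E. neutral_pair e} = Suc N \<longleftrightarrow> card {e \<in> ?E'. neutral_pair e} = N"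
    unfolding count pair_kinds using col by simp
  moreover have "card {e \<in> ?E. charged_pair e} = Oc \<longleftrightarrow> card {e \<in> ?E'. charged_pair e} = Suc Oc"
    unfolding count charged_pair_def pair_kinds using col \<open>w \<noteq> v\<close> by simp
  moreover have "int (card {v \<in> F. red v}) - int (card {v \<in> F. green v}) =
        int (card {e \<in> ?E. green_pair e}) - int (card {e \<in> ?E. red_pair e}) \<longleftrightarrow>
      int (card {v \<in> insert u F. red v}) - int (card {v \<in> insert u F. green v}) =
        int (card {e \<in> ?E'. green_pair e}) - int (card {e \<in> ?E'. red_pair e})"
    unfolding count pair_kinds using col \<open>w \<noteq> v\<close> by (cases "red u") simp_all
  ultimately show ?thesis
    unfolding admissible_pairs_def in_balance_def verts_faulty_hypercube by argo
qed

text \<open>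
  Indexing the colour of a charged pair by a truth value lets the majority colour be a variable, so
  that no argument has to be repeated with the colours exchanged.
\<close>

definition mono_pair :: "bool \<Rightarrow> bool list set \<Rightarrow> bool" where
  "mono_pair c e \<longleftrightarrow> (if c then red_pair e else green_pair e)"

lemma mono_pair_doubleton: "mono_pair c {a, b} \<longleftrightarrow> a \<noteq> b \<and> red a = c \<and> red b = c"
  by (auto simp: mono_pair_def pair_kinds)

lemma disjoint_pairs_doubleton:
  assumes "disjoint_pairs E" "e \<in> E"
  obtains a b where "e = {a, b}" "a \<noteq> b"
  using assms by (auto simp: disjoint_pairs_def card_2_iff)

lemma card_coloured_ends:
  assumes E: "disjoint_pairs E" and "finite E"
  shows "card {x \<in> \<Union>E. red x = c} =
    card {e \<in> E. neutral_pair e} + 2 * card {e \<in> E. mono_pair c e}"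
proof -
  have one: "card {x \<in> e. red x = c} =
      (if neutral_pair e then 1 else 0) + 2 * (if mono_pair c e then 1 else 0)" if "e \<in> E" for e
  proof -
    obtain a b where ab: "e = {a, b}" "a \<noteq> b"
      using disjoint_pairs_doubleton[OF E \<open>e \<in> E\<close>] .
    have "{x \<in> e. red x = c} = (if red a = c then {a} else {}) \<union> (if red b = c then {b} else {})"
      using ab by auto
    then show ?thesis
      using ab by (auto simp: pair_kinds mono_pair_doubleton)
  qed
  have fin: "finite e" if "e \<in> E" for e
    using disjoint_pairs_doubleton[OF E that] by auto
  have "{x \<in> \<Union>E. red x = c} = (\<Union>e\<in>E. {x \<in> e. red x = c})"
    by auto
  also have "card \<dots> = (\<Sum>e\<in>E. card {x \<in> e. red x = c})"
    using E \<open>finite E\<close> fin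
    by (intro card_UN_disjoint) (auto simp: disjoint_pairs_def dest: disjointD)
  also have "\<dots> = (\<Sum>e\<in>E. (if neutral_pair e then 1 else 0) + 2 * (if mono_pair c e then 1 else 0))"
    by (intro sum.cong refl one)
  also have "\<dots> = card {e \<in> E. neutral_pair e} + 2 * card {e \<in> E. mono_pair c e}"
    using \<open>finite E\<close> by (simp add: sum.distrib sum_distrib_left[symmetric] flip: sum.inter_filter)
  finally show ?thesis .
qed

lemma card_charged_pairs:
  assumes "finite E"
  shows "card {e \<in> E. charged_pair e} = card {e \<in> E. mono_pair c e} + card {e \<in> E. mono_pair (\<not> c) e}"
proof -
  have "{e \<in> E. charged_pair e} = {e \<in> E. mono_pair c e} \<union> {e \<in> E. mono_pair (\<not> c) e}"
    by (auto simp: charged_pair_def mono_pair_def)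
  moreover have "\<not> (mono_pair c e \<and> mono_pair (\<not> c) e)" for e
    by (cases c) (auto simp: mono_pair_def red_pair_def green_pair_def doubleton_eq_iff)
  then have "{e \<in> E. mono_pair c e} \<inter> {e \<in> E. mono_pair (\<not> c) e} = {}" by auto
  ultimately show ?thesis
    using assms by (simp add: card_Un_disjoint)
qed

lemma admissible_pairs_finite:
  assumes "admissible_pairs n F N Oc E"
  shows "finite E"
proof -
  have "\<Union>E \<subseteq> {v. length v = n}"
    using assms by (auto simp: admissible_pairs_def in_balance_def)
  then show ?thesis
    using finite_pverts_hypercube finite_subset finite_UnionD by blast
qed

lemma admissible_pairs_balance:
  assumes "admissible_pairs n F N Oc E"
  shows "int (card {v \<in> F. red v = c}) - int (card {v \<in> F. red v \<noteq> c}) =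
      int (card {e \<in> E. mono_pair (\<not> c) e}) - int (card {e \<in> E. mono_pair c e})"
  using assms by (cases c) (auto simp: admissible_pairs_def in_balance_def mono_pair_def)

lemma charge_colour:
  "charge F = \<bar>int (card {v \<in> F. red v = c}) - int (card {v \<in> F. red v \<noteq> c})\<bar>"
  by (cases c) (auto simp: charge_def)

lemma charge_majority:
  obtains c where "int (card {v \<in> F. red v = c}) - int (card {v \<in> F. red v \<noteq> c}) = charge F"
proof (cases "card {v \<in> F. red v} \<ge> card {v \<in> F. green v}")
  case True
  then show ?thesis using that[of True] by (simp add: charge_def)
next
  case False
  then show ?thesis using that[of False] by (simp add: charge_def)
qed

lemma mass_split:
  assumes "finite F"
  shows "mass F = card {v \<in> F. red v = c} + card {v \<in> F. red v \<noteq> c}"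
proof -
  have "F = {v \<in> F. red v = c} \<union> {v \<in> F. red v \<noteq> c}" by auto
  then have "card F = card ({v \<in> F. red v = c} \<union> {v \<in> F. red v \<noteq> c})" by simp
  also have "\<dots> = card {v \<in> F. red v = c} + card {v \<in> F. red v \<noteq> c}"
    using assms by (intro card_Un_disjoint) auto
  finally show ?thesis by (simp add: mass_def)
qed

lemma insert_majority_vertex:
  assumes "fault n F" "length u = n" "u \<notin> F"
    and maj: "int (card {v \<in> F. red v = red u}) - int (card {v \<in> F. red v \<noteq> red u}) = charge F"
  shows "fault n (insert u F)" "mass (insert u F) = mass F + 1"
    "charge (insert u F) = charge F + 1"
proof -
  have fin: "finite F"
    using assms(1) finite_pverts_hypercube by (auto simp: fault_def intro: finite_subset)
  show "fault n (insert u F)" using assms by (auto simp: fault_def)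
  show "mass (insert u F) = mass F + 1" using fin \<open>u \<notin> F\<close> by (simp add: mass_def)
  show "charge (insert u F) = charge F + 1"
    using maj unfolding charge_colour[of _ "red u"] card_Collect_insert[OF fin \<open>u \<notin> F\<close>]
    by simp
qed

section \<open>Trading a neutral pair for a charged one\<close>

text \<open>
  The set \<open>U\<close> consists of the ends of majority colour \<open>c\<close> of the neutral pairs, and \<open>W\<close>
  collects all obstructions among their possible neighbours. Balance forces \<open>(Oc + C) / 2\<close> of the
  charged pairs to have the colour opposite to \<open>c\<close>, which determines the number of obstructions,
  and the hypothesis on the dimension says that \<open>U\<close> has more neighbours than that.
\<close>

lemma exists_free_neighbour:
  assumes F: "finite F"
    and maj: "int (card {v \<in> F. red v = c}) - int (card {v \<in> F. red v \<noteq> c}) = int C"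
    and mass: "mass F = M" and adm: "admissible_pairs n F N Oc E" and "N \<ge> 1"
    and room: "M + C + 2 * N + 2 * Oc + 2 * (Suc N choose 2) < 2 * (n * N + 1)"
  obtains u v w where "{u, v} \<in> E" "red u = c" "red v \<noteq> c"
    "(u, w) \<in> parcs (hypercube n)" "w \<notin> F" "w \<notin> \<Union>E"
proof -
  have E: "disjoint_pairs E" and inV: "\<Union>E \<subseteq> {v. length v = n} - F"
    and cN: "card {e \<in> E. neutral_pair e} = N" and cO: "card {e \<in> E. charged_pair e} = Oc"
    using adm by (auto simp: admissible_pairs_def in_balance_def)
  have finE: "finite E" using adm by (rule admissible_pairs_finite)
  let ?EN = "{e \<in> E. neutral_pair e}"
  define U where "U = {x \<in> \<Union>?EN. red x = c}"
  define W where "W = {v \<in> F. red v \<noteq> c} \<union> {x \<in> \<Union>E. red x = (\<not> c)}"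
  have "disjoint_pairs ?EN"
    using E by (auto simp: disjoint_pairs_def disjoint_def)
  moreover have "{e \<in> ?EN. neutral_pair e} = ?EN" "{e \<in> ?EN. mono_pair c e} = {}"
    by (auto simp: neutral_pair_def mono_pair_doubleton)
  ultimately have cU: "card U = N"
    using card_coloured_ends[of ?EN c] finE cN unfolding U_def by simp
  have "card W \<le> card {v \<in> F. red v \<noteq> c} + card {x \<in> \<Union>E. red x = (\<not> c)}"
    unfolding W_def by (rule card_Un_le)
  then have "2 * card W \<le> M + C + 2 * N + 2 * Oc"
    using card_coloured_ends[OF E finE, of "\<not> c"] mass_split[OF F, of c] mass maj
      admissible_pairs_balance[OF adm, of c] card_charged_pairs[OF finE, of c] cN cO
    by linarith
  moreover have "n * N + 1 \<le> card (parcs (hypercube n) `` U) + (Suc N choose 2)"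
    using card_neighbours_hypercube[of U n] cU \<open>N \<ge> 1\<close> inV by (fastforce simp: U_def)
  ultimately have "card W < card (parcs (hypercube n) `` U)"
    using room by presburger
  moreover have "finite W"
    unfolding W_def using F inV finite_pverts_hypercube[of n]
    by (auto intro: finite_subset[of _ "{v. length v = n}"])
  ultimately obtain w where w: "w \<in> parcs (hypercube n) `` U" "w \<notin> W"
    by (metis card_mono not_less subsetI)
  then obtain u where u: "u \<in> U" "(u, w) \<in> parcs (hypercube n)" by auto
  then obtain e where e: "e \<in> E" "neutral_pair e" "u \<in> e" "red u = c" by (auto simp: U_def)
  then obtain v where v: "e = {u, v}" "red v \<noteq> c"
    by (auto simp: neutral_pair_def)
  have "red w = (\<not> c)" using parcs_hypercube_red[OF u(2)] e(4) by simp
  then have "w \<notin> F" "w \<notin> \<Union>E" using w(2) by (auto simp: W_def)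
  with that e v u show thesis by blast
qed

lemma exists_free_vertex:
  assumes F: "finite F" and "n > 0" and half: "2 * card {v \<in> F. red v = c} < 2 ^ n"
  obtains u where "length u = n" "u \<notin> F" "red u = c"
proof -
  obtain m where n: "n = Suc m"
    using \<open>n > 0\<close> gr0_conv_Suc by auto
  have "\<not> {v. length v = n \<and> red v = c} \<subseteq> {v \<in> F. red v = c}"
  proof
    assume "{v. length v = n \<and> red v = c} \<subseteq> {v \<in> F. red v = c}"
    then have "card {v. length v = n \<and> red v = c} \<le> card {v \<in> F. red v = c}"
      using F by (intro card_mono) auto
    then show False using half card_colour_class[of m c] n by simp
  qed
  with that show thesis by auto
qed

text \<open>
  The argument for a single dimension and a single fault. The bound \<open>room\<close> provides the free
  neighbour for the coverings, while \<open>size\<close> leaves a vertex of the majority colour undeleted,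
  without which no larger fault would be available to obtain an admissible set of pairs.
\<close>

lemma freely_prescribe_ends_if_larger_fault:
  assumes F: "fault n F" "mass F = M" "charge F = int C" and "N \<ge> 1"
    and room: "M + C + 2 * N + 2 * Oc + 2 * (Suc N choose 2) < 2 * (n * N + 1)"
    and size: "M + C < 2 ^ n"
    and larger: "\<And>F'. fault n F' \<Longrightarrow> mass F' = M + 1 \<Longrightarrow> charge F' = int (C + 1) \<Longrightarrow>
      freely_prescribe_ends n F' (N - 1) (Oc + 1)"
  shows "freely_prescribe_ends n F N Oc"
  unfolding freely_prescribe_ends_def
proof (intro conjI allI impI)
  have finF: "finite F"
    using F(1) finite_pverts_hypercube by (auto simp: fault_def intro: finite_subset)
  have "n > 0" using room \<open>N \<ge> 1\<close> by (cases n) auto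
  obtain c where c: "int (card {v \<in> F. red v = c}) - int (card {v \<in> F. red v \<noteq> c}) = int C"
    using charge_majority[of F] F(3) by auto
  have step: "freely_prescribe_ends n (insert u F) (N - 1) (Oc + 1)"
    if "length u = n" "u \<notin> F" "red u = c" for u
    using insert_majority_vertex[OF F(1) that(1,2)] F c that(3) larger by auto
  show "\<exists>E. admissible_pairs n F N Oc E"
  proof -
    obtain u where u: "length u = n" "u \<notin> F" "red u = c"
      using exists_free_vertex[OF finF \<open>n > 0\<close>, of c] mass_split[OF finF, of c] F(2) c size
      by auto
    then obtain E where E: "admissible_pairs n (insert u F) (N - 1) (Oc + 1) E"
      using step[OF u] unfolding freely_prescribe_ends_def by blast
    \<comment> \<open>The larger fault has positive charge, so balance forces a charged pair of minority colour.\<close>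
    have "card {e \<in> E. mono_pair (\<not> c) e} > 0"
      using admissible_pairs_balance[OF E, of c] c u(3)
      unfolding card_Collect_insert[OF finF u(2)] by presburger
    then obtain e where e: "e \<in> E" "mono_pair (\<not> c) e"
      by (metis (mono_tags, lifting) card_gt_0_iff ex_in_conv mem_Collect_eq)
    have dE: "disjoint_pairs E" using E by (simp add: admissible_pairs_def)
    obtain w v where wv: "e = {w, v}" "w \<noteq> v"
      using disjoint_pairs_doubleton[OF dE e(1)] .
    with e have col: "red w = (\<not> c)" "red v = (\<not> c)" by (auto simp: mono_pair_doubleton)
    define D where "D = E - {e}"
    have ED: "E = insert {w, v} D" using e wv by (auto simp: D_def)
    have finD: "finite D" using admissible_pairs_finite[OF E] by (simp add: D_def)
    have "{w, v} \<inter> \<Union>D = {}"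
      using disjoint_pairs_rest[OF dE e(1)] wv(1) by (simp add: D_def)
    moreover have "\<Union>E \<subseteq> {v. length v = n} - insert u F"
      using E by (simp add: admissible_pairs_def in_balance_def)
    ultimately have "{u, v, w} \<subseteq> {v. length v = n} - F" "{u, v, w} \<inter> \<Union>D = {}"
      using u unfolding ED by auto
    then have "admissible_pairs n F (Suc (N - 1)) Oc (insert {u, v} D)"
      using E finD finF col u(3) wv(2) admissible_pairs_exchange[of F D u v w n "N - 1" Oc]
      unfolding ED by simp
    with \<open>N \<ge> 1\<close> show ?thesis by auto
  qed
  fix E assume E: "admissible_pairs n F N Oc E"
  obtain u v w where *: "{u, v} \<in> E" "red u = c" "red v \<noteq> c"
    "(u, w) \<in> parcs (hypercube n)" "w \<notin> F" "w \<notin> \<Union>E"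
    using exists_free_neighbour[OF finF c F(2) E \<open>N \<ge> 1\<close> room] .
  have dE: "disjoint_pairs E" and inV: "\<Union>E \<subseteq> {v. length v = n} - F"
    using E by (simp_all add: admissible_pairs_def in_balance_def)
  define D where "D = E - {{u, v}}"
  have ED: "E = insert {u, v} D" using * by (auto simp: D_def)
  have dis: "{u, v, w} \<inter> \<Union>D = {}"
    using disjoint_pairs_rest[OF dE *(1)] *(6) by (auto simp: D_def)
  have uF: "length u = n" "u \<notin> F" using inV *(1) by auto
  have "finite D" using admissible_pairs_finite[OF E] by (simp add: D_def)
  moreover have "{u, v, w} \<subseteq> {v. length v = n} - F"
    using inV *(1,5) parcs_hypercube_length[OF *(4)] by auto
  moreover have "red v \<longleftrightarrow> \<not> red u" "red w \<longleftrightarrow> \<not> red u" "w \<noteq> v"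
    using *(1-3,6) parcs_hypercube_red[OF *(4)] by auto
  ultimately have "admissible_pairs n (insert u F) (N - 1) (Suc Oc) (insert {w, v} D)"
    using E \<open>N \<ge> 1\<close> finF dis admissible_pairs_exchange[of F D u v w n "N - 1" Oc]
    unfolding ED by simp
  then obtain P where P: "path_covering (faulty_hypercube n (insert u F)) P"
    "path_ends ` P = insert {w, v} D"
    using step[OF uF *(2)] by (auto simp: freely_prescribe_ends_def)
  have "{w, v} \<notin> D" using dis by auto
  then show "\<exists>P. path_covering (faulty_hypercube n F) P \<and> path_ends ` P = E"
    unfolding ED by (rule path_covering_extend[OF P _ *(4) uF(2)])
qed

theorem lemma5p3:
  fixes M C N Oc k :: nat
  assumes "even C \<longleftrightarrow> even M" and "even Oc \<longleftrightarrow> even M"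
    and "C \<le> M" and "Oc \<ge> C" and "N \<ge> 1"
    and "k > 0"
    and "real k * real N + 1 - real ((N + 1) choose 2) > (real M + real C) / 2 + real N + real Oc"
    and "k \<in> A_set (M + 1) (C + 1) (N - 1) (Oc + 1)"
  shows "k \<in> A_set M C N Oc"
proof -
  have log: "log 2 (real (M + 1 + (C + 1) + 2 * (N - 1) + 2 * (Oc + 1))) \<le> real k"
    and larger: "\<And>n F. n \<ge> k \<Longrightarrow> fault n F \<Longrightarrow> mass F = M + 1 \<Longrightarrow> charge F = int (C + 1) \<Longrightarrow>
      freely_prescribe_ends n F (N - 1) (Oc + 1)"
    using assms(8) unfolding A_set_def by blast+
  \<comment> \<open>Trading a neutral for a charged pair keeps the number of ends, so the bound known for the
    larger fault exceeds the required one by the 2 units of additional mass and charge.\<close>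
  have size: "real (M + C + 2 * N + 2 * Oc + 2) \<le> 2 ^ k"
  proof -
    have "M + 1 + (C + 1) + 2 * (N - 1) + 2 * (Oc + 1) = M + C + 2 * N + 2 * Oc + 2"
      using \<open>N \<ge> 1\<close> by simp
    with log show ?thesis
      by (simp add: log_le_iff powr_realpow del: of_nat_add of_nat_mult)
  qed
  have "log 2 (real (M + C + 2 * N + 2 * Oc)) \<le> real k"
    using size \<open>N \<ge> 1\<close> by (subst log_le_iff) (auto simp: powr_realpow)
  moreover have "freely_prescribe_ends n F N Oc"
    if "n \<ge> k" "fault n F" "mass F = M" "charge F = int C" for n F
  proof (rule freely_prescribe_ends_if_larger_fault[OF that(2-4) \<open>N \<ge> 1\<close>])
    have "real (M + C + 2 * N + 2 * Oc + 2 * (Suc N choose 2)) < real (2 * (k * N + 1))"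
      using assms(7) by (simp, argo)
    then have "M + C + 2 * N + 2 * Oc + 2 * (Suc N choose 2) < 2 * (k * N + 1)"
      by (simp only: of_nat_less_iff)
    also have "\<dots> \<le> 2 * (n * N + 1)" using \<open>n \<ge> k\<close> by simp
    finally show "M + C + 2 * N + 2 * Oc + 2 * (Suc N choose 2) < 2 * (n * N + 1)" .
    have "real (M + C) < 2 ^ k" using size by simp
    also have "(2 :: real) ^ k \<le> 2 ^ n" using \<open>n \<ge> k\<close> by simp
    finally have "real (M + C) < real (2 ^ n)" by simp
    then show "M + C < 2 ^ n" by (simp only: of_nat_less_iff)
    show "freely_prescribe_ends n F' (N - 1) (Oc + 1)"
      if "fault n F'" "mass F' = M + 1" "charge F' = int (C + 1)" for F'
      using larger \<open>n \<ge> k\<close> that by blast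
  qed
  ultimately show ?thesis unfolding A_set_def by blast
qed

end
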